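(* Let $(\alpha_n,\beta_n)_{n\in\mathbb{Z}}$ be a bilateral Bailey pair relative to $a$. For all $N\geq0$, define \[ \alpha^{(N)}_n=(1-aq^{2n-N})(aq^{1-N})_N\sum_{j\in\mathbb{Z}}(-1)^j\frac{a^jq^{(2n-N)j-j(j+1)/2}}{(aq^{2n-N-j})_{N+1}}\begin{bmatrix}N\\ j\end{bmatrix}\alpha_{n-j},\qquad \beta^{(N)}_n=\beta_n . \] Then $(\alpha^{(N)}_n,\beta^{(N)}_n)$ is a bilateral Bailey pair relative to $aq^{-N}$.
   Context: Fix complex numbers $a,q$ with $|q|<1$ (parameters generic so that no denominator vanishes). For complex $x$, $(x)_\infty=\prod_{j\ge0}(1-xq^j)$ and for $k\in\mathbb{Z}$, $(x)_k=(x)_\infty/(xq^k)_\infty$ (so $1/(q)_k=0$ for $k<0$). A bilateral Bailey pair relative to $c$ is a pair of sequences $(\alpha_n)_{n\in\mathbb{Z}},(\beta_n)_{n\in\mathbb{Z}}$ such that for every $n\in\mathbb{Z}$, $\beta_n=\sum_{j\le n}\frac{\alpha_j}{(q)_{n-j}(cq)_{n+j}}$ (the series being convergent). For integers $N\ge0$ and $j$, $\begin{bmatrix}N\\ j\end{bmatrix}=\frac{(q)_N}{(q)_j(q)_{N-j}}$ if $0\le j\le N$ and $0$ otherwise. *)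

theory Defs
  imports "HOL-Analysis.Analysis"
begin

text \<open>
  The \<open>q\<close>-shifted factorials, with the base \<open>q\<close> as explicit first argument. Division by zero
  being zero, \<open>1 / qpoch q q k = 0\<close> for \<open>k < 0\<close>, in accordance with the usual convention.
\<close>

definition qpoch_inf :: "complex \<Rightarrow> complex \<Rightarrow> complex" where
  "qpoch_inf q x = (\<Prod>j. 1 - x * q ^ j)"

definition qpoch :: "complex \<Rightarrow> complex \<Rightarrow> int \<Rightarrow> complex" where
  "qpoch q x k = qpoch_inf q x / qpoch_inf q (x * q powi k)"

definition qbinom :: "complex \<Rightarrow> nat \<Rightarrow> int \<Rightarrow> complex" where
  "qbinom q N j =
     (if 0 \<le> j \<and> j \<le> int N
      then qpoch q q (int N) / (qpoch q q j * qpoch q q (int N - j)) else 0)"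

text \<open>
  The series over all integers \<open>j \<le> n\<close> is summed in the order \<open>j = n, n - 1, n - 2, \<dots>\<close>
  by substituting \<open>j = n - int i\<close>; only ordinary (not absolute) convergence is demanded.
\<close>

definition bilateral_bailey_pair ::
    "complex \<Rightarrow> complex \<Rightarrow> (int \<Rightarrow> complex) \<Rightarrow> (int \<Rightarrow> complex) \<Rightarrow> bool" where
  "bilateral_bailey_pair q c \<alpha> \<beta> \<longleftrightarrow>
     (\<forall>n. (\<lambda>i. let j = n - int i in \<alpha> j / (qpoch q q (n - j) * qpoch q (c * q) (n + j))) sums \<beta> n)"

text \<open>
  The sum over \<open>j\<close> has finite support, the summand being zero unless \<open>0 \<le> j \<le> N\<close>.
  The integer division by 2 is exact.
\<close>

definition bailey_alpha ::
    "complex \<Rightarrow> complex \<Rightarrow> (int \<Rightarrow> complex) \<Rightarrow> nat \<Rightarrow> int \<Rightarrow> complex" where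
  "bailey_alpha q a \<alpha> N n =
     (1 - a * q powi (2 * n - int N)) * qpoch q (a * q powi (1 - int N)) (int N) *
     (\<Sum>\<^sub>\<infinity>j\<in>UNIV. (-1) powi j *
        (a powi j * q powi ((2 * n - int N) * j - j * (j + 1) div 2)
          / qpoch q (a * q powi (2 * n - int N - j)) (int N + 1)) *
        qbinom q N j * \<alpha> (n - j))"

definition bailey_beta :: "(int \<Rightarrow> complex) \<Rightarrow> nat \<Rightarrow> int \<Rightarrow> complex" where
  "bailey_beta \<beta> N n = \<beta> n"

end

theory Submission imports Defs begin

text \<open>
  For \<open>N = 1\<close> the sum defining \<open>\<beta>\<close> changes only by a telescoping series
  whose general term is a bounded multiple of a term of the given convergent series, hence tends to
  zero; so ordinary convergence suffices. By the two \<open>q\<close>-Pascal rules, the transformation with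
  parameter \<open>N + 1\<close> is the one with parameter \<open>N\<close> followed by the case \<open>N = 1\<close>
  relative to \<open>a q\<^sup>-\<^sup>N\<close>, and the theorem follows by induction.
\<close>

context
  fixes q :: complex
  assumes q_nz: "q \<noteq> 0" and norm_q: "norm q < 1"
begin

section \<open>Infinite products and q-shifted factorials\<close>

lemma convergent_prod_qpoch_inf: "convergent_prod (\<lambda>j. 1 - x * q ^ j)"
proof -
  have "summable (\<lambda>j. norm x * norm q ^ j)"
    using norm_q by (intro summable_mult summable_geometric) simp
  then show ?thesis
    by (intro abs_convergent_prod_imp_convergent_prod summable_imp_abs_convergent_prod)
       (simp add: norm_mult norm_power)
qed

lemma qpoch_inf_rec: "qpoch_inf q x = (1 - x) * qpoch_inf q (x * q)"
proof -
  have "(\<lambda>j. 1 - x * q ^ Suc j) has_prod qpoch_inf q (x * q)"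
    using convergent_prod_has_prod[OF convergent_prod_qpoch_inf[of "x * q"]]
    by (simp add: qpoch_inf_def mult.assoc)
  from has_prod_Suc_imp[where f = "\<lambda>j. 1 - x * q ^ j", OF this] show ?thesis
    unfolding qpoch_inf_def by (simp add: has_prod_unique[symmetric] mult.commute)
qed

lemma qpoch_inf_nonzero: "(\<And>j. x * q ^ j \<noteq> 1) \<Longrightarrow> qpoch_inf q x \<noteq> 0"
  unfolding qpoch_inf_def
  by (rule prodinf_nonzero[OF convergent_prod_qpoch_inf]) (metis eq_iff_diff_eq_0)

text \<open>The last factor comes from the denominator product, which must not vanish. For x = q and
  k = -1 the excluded equation holds and the rule fails: the left side is 1, the right side
  0.\<close>

lemma qpoch_plus_1:
  assumes "x * q powi k \<noteq> 1"
  shows "qpoch q x (k + 1) = qpoch q x k * (1 - x * q powi k)"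
  using assms qpoch_inf_rec[of "x * q powi k"] q_nz
  by (simp add: qpoch_def power_int_add mult.assoc)

text \<open>The first factor comes from the numerator product, so the base moves from x to xq. This
  links the factorials of pairs relative to b and to b/q.\<close>

lemma qpoch_plus_1': "qpoch q x (k + 1) = (1 - x) * qpoch q (x * q) k"
  using qpoch_inf_rec[of x] q_nz
  by (simp add: qpoch_def power_int_add mult_ac)

lemma qpoch_nonzero:
  assumes "\<And>k::int. x * q powi k \<noteq> 1"
  shows "qpoch q x k \<noteq> 0"
proof -
  have "qpoch_inf q x \<noteq> 0"
    using assms[of "int _"] by (intro qpoch_inf_nonzero) (simp add: power_int_of_nat)
  moreover have "qpoch_inf q (x * q powi k) \<noteq> 0"
    using assms[of "k + int _"] q_nz
    by (intro qpoch_inf_nonzero) (simp add: power_int_add power_int_of_nat mult.assoc)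
  ultimately show ?thesis by (simp add: qpoch_def)
qed

lemma q_power_int_neq_1:
  assumes "k > 0"
  shows "q powi k \<noteq> 1"
proof -
  obtain m where "k = int m" "m > 0" using assms by (metis zero_less_imp_eq_int)
  then show ?thesis
    using norm_q power_less_one_iff[of "norm q" m]
    by (auto simp: power_int_of_nat norm_power[symmetric])
qed

lemma qpoch_q_rec:
  assumes "k > 0"
  shows "qpoch q q k = qpoch q q (k - 1) * (1 - q powi k)"
proof -
  have "q * q powi (k - 1) = q powi k"
    using q_nz by (simp add: power_int_diff)
  then show ?thesis
    using qpoch_plus_1[of q "k - 1"] q_power_int_neq_1[OF assms] by simp
qed

lemma qpoch_0:
  assumes "\<And>k::int. x * q powi k \<noteq> 1"
  shows "qpoch q x 0 = 1"
  using assms[of "int _"]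
  by (simp add: qpoch_def power_int_of_nat qpoch_inf_nonzero)

text \<open>The case x = q violates the hypothesis of \<open>qpoch_0\<close> at k = -1, but only the
  factors with j >= 0 enter.\<close>

lemma qpoch_q_0: "qpoch q q 0 = 1"
proof -
  have "q * q ^ j \<noteq> 1" for j
    using q_power_int_neq_1[of "int (Suc j)"] by (simp add: power_int_of_nat del: of_nat_Suc)
  then show ?thesis by (simp add: qpoch_def qpoch_inf_nonzero)
qed

lemma qpoch_q_nonzero: "qpoch q q (int k) \<noteq> 0"
proof (induction k)
  case (Suc k)
  then show ?case
    using qpoch_q_rec[of "int (Suc k)"] q_power_int_neq_1[of "int (Suc k)"] by simp
qed (simp add: qpoch_q_0)

lemma qpoch_q_nonzero': "k \<ge> 0 \<Longrightarrow> qpoch q q k \<noteq> 0"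
  using qpoch_q_nonzero[of "nat k"] by simp

section \<open>The two q-Pascal rules\<close>

lemma
  shows qbinom_Suc_left: "qbinom q (Suc N) j = q powi j * qbinom q N j + qbinom q N (j - 1)"
    and qbinom_Suc_right:
      "qbinom q (Suc N) j = qbinom q N j + q powi (int N + 1 - j) * qbinom q N (j - 1)"
proof -
  have "qbinom q (Suc N) j = q powi j * qbinom q N j + qbinom q N (j - 1) \<and>
    qbinom q (Suc N) j = qbinom q N j + q powi (int N + 1 - j) * qbinom q N (j - 1)"
  proof (cases "1 \<le> j \<and> j \<le> int N")
    case True
    \<comment> \<open>Multiplied by BUCV/A, the left side becomes 1 - (1-U)(1-V), and the right
      sides become (1-U)V + U and V + (1-V)U, which both equal it.\<close>
    define A B C U V where "A = qpoch q q (int N)"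
      and "B = qpoch q q (j - 1)" and "C = qpoch q q (int N - j)"
      and "U = 1 - q powi j" and "V = 1 - q powi (int N + 1 - j)"
    have nz: "B \<noteq> 0" "C \<noteq> 0" "U \<noteq> 0" "V \<noteq> 0"
      using True q_power_int_neq_1[of j] q_power_int_neq_1[of "int N + 1 - j"]
      by (auto simp: B_def C_def U_def V_def qpoch_q_nonzero')
    have "q powi (int N + 1) = (1 - U) * (1 - V)"
      using q_nz by (simp add: U_def V_def flip: power_int_add)
    then have "qpoch q q (int (Suc N)) = A * (1 - (1 - U) * (1 - V))"
      using qpoch_q_rec[of "int N + 1"] by (simp add: A_def add.commute)
    moreover have j: "qpoch q q j = B * U"
      using True qpoch_q_rec[of j] by (simp add: B_def U_def)
    moreover have Nj: "qpoch q q (int N + 1 - j) = C * V"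
      using True qpoch_q_rec[of "int N + 1 - j"] by (simp add: C_def V_def algebra_simps)
    moreover have "int (Suc N) - j = int N + 1 - j" by simp
    ultimately have N1j: "qbinom q (Suc N) j = A * (1 - (1 - U) * (1 - V)) / ((B * U) * (C * V))"
      using True by (simp add: qbinom_def add.commute)
    have Nj0: "qbinom q N j = A / ((B * U) * C)"
      using True j by (simp add: qbinom_def A_def C_def)
    have "qpoch q q (int N - (j - 1)) = C * V"
      by (simp only: Nj diff_diff_eq2)
    then have Nj1: "qbinom q N (j - 1) = A / (B * (C * V))"
      using True by (simp add: qbinom_def A_def B_def del: diff_diff_eq2)
    have pow: "q powi j = 1 - U" "q powi (int N + 1 - j) = 1 - V"
      by (simp_all add: U_def V_def)
    show ?thesis
      unfolding N1j Nj0 Nj1 pow using nz by (simp add: field_simps)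
  next
    case False
    \<comment> \<open>At j = 0 or j = N + 1 the computation above would divide by (q) with index -1,
      which is zero; there one coefficient of level N vanishes by definition.\<close>
    then consider "j < 0" | "j = 0" | "j = int N + 1" | "j > int N + 1" by linarith
    then show ?thesis
      using qpoch_q_nonzero[of "Suc N"]
      by cases (auto simp: qbinom_def qpoch_q_0 qpoch_q_nonzero add.commute)
  qed
  then show "qbinom q (Suc N) j = q powi j * qbinom q N j + qbinom q N (j - 1)"
    and "qbinom q (Suc N) j = qbinom q N j + q powi (int N + 1 - j) * qbinom q N (j - 1)"
    by blast+
qed

section \<open>The case N = 1, by telescoping\<close>

text \<open>For b nonzero, b q^(2(n-i)) is unbounded in i; multiplying numerator and denominator by
  q^(2i) shows that the limit is -1. For b = 0 it is 0.\<close>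

lemma convergent_telescoping_factor:
  "convergent (\<lambda>i. b * q powi (2 * (n - int i)) / (1 - b * q powi (2 * (n - int i))))"
proof (cases "b = 0")
  case False
  have "norm (q\<^sup>2) < 1"
    using norm_q by (simp add: norm_power power_less_one_iff)
  then have "(\<lambda>i. b * q powi (2 * n) / ((q\<^sup>2) ^ i - b * q powi (2 * n)))
      \<longlonglongrightarrow> b * q powi (2 * n) / (0 - b * q powi (2 * n))"
    using False q_nz by (intro tendsto_intros) auto
  moreover have "b * q powi (2 * n) / ((q\<^sup>2) ^ i - b * q powi (2 * n)) =
      b * q powi (2 * (n - int i)) / (1 - b * q powi (2 * (n - int i)))" for i
  proof -
    have "q powi (2 * (n - int i)) = q powi (2 * n) / (q\<^sup>2) ^ i"
      using q_nz power_int_diff[of q "2 * n" "int (2 * i)"]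
      by (simp only: power_int_of_nat power_mult) (simp add: algebra_simps)
    moreover have "1 - b * (q powi (2 * n) / (q\<^sup>2) ^ i) = ((q\<^sup>2) ^ i - b * q powi (2 * n)) / (q\<^sup>2) ^ i"
      using q_nz by (simp add: field_simps)
    ultimately show ?thesis using q_nz by simp
  qed
  ultimately show ?thesis by (auto simp: convergent_def)
qed (simp add: convergent_const)

text \<open>These are the terms j = 0 and j = 1 of \<open>bailey_alpha\<close> for N = 1, after
  cancelling 1 - b q^(2n-1).\<close>

definition bailey_step :: "complex \<Rightarrow> (int \<Rightarrow> complex) \<Rightarrow> int \<Rightarrow> complex" where
  "bailey_step b \<alpha> n = (1 - b) * (\<alpha> n / (1 - b * q powi (2 * n))
     - b * q powi (2 * (n - 1)) * \<alpha> (n - 1) / (1 - b * q powi (2 * (n - 1))))"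

text \<open>Each value of \<alpha> enters two neighbouring terms of the new series: that at n - i
  contributes \<open>t i + w i\<close> to term i and \<open>- w i\<close> to term i - 1, so its
  total weight is still \<open>t i\<close>.\<close>

lemma bilateral_bailey_pair_step:
  assumes gen: "\<And>k::int. b * q powi k \<noteq> 1"
    and pair: "bilateral_bailey_pair q b \<alpha> \<beta>"
  shows "bilateral_bailey_pair q (b / q) (bailey_step b \<alpha>) \<beta>"
  unfolding bilateral_bailey_pair_def Let_def
proof
  fix n :: int
  define t where "t i = \<alpha> (n - int i) / (qpoch q q (int i) * qpoch q (b * q) (2 * n - int i))" for i
  define r where "r i = b * q powi (2 * (n - int i)) / (1 - b * q powi (2 * (n - int i)))" for i
  \<comment> \<open>The factor 1 - q^i makes \<open>w 0\<close> vanish, so no boundary term is left,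
    and in \<open>w (Suc i)\<close> it cancels the last factor of (q)_(i+1).\<close>
  define w where "w i = t i * r i * (1 - q ^ i)" for i
  have t: "t sums \<beta> n"
    using pair unfolding bilateral_bailey_pair_def Let_def
    by (auto simp: t_def[abs_def] algebra_simps elim!: allE[of _ n])
  have "w \<longlonglongrightarrow> 0"
  proof -
    obtain l where "r \<longlonglongrightarrow> l"
      using convergent_telescoping_factor[of b n] by (auto simp: convergent_def r_def[abs_def])
    moreover have "t \<longlonglongrightarrow> 0" using t summable_LIMSEQ_zero sums_summable by blast
    ultimately have "w \<longlonglongrightarrow> 0 * l * (1 - 0)"
      unfolding w_def[abs_def] using norm_q by (intro tendsto_intros)
    then show ?thesis by simp
  qed
  then have "(\<lambda>i. w i - w (Suc i)) sums (w 0 - 0)" by (rule telescope_sums')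
  with t have "(\<lambda>i. t i + (w i - w (Suc i))) sums (\<beta> n + (w 0 - 0))" by (rule sums_add)
  then have sums: "(\<lambda>i. t i + (w i - w (Suc i))) sums \<beta> n" by (simp add: w_def)
  have step: "bailey_step b \<alpha> (n - int i) / (qpoch q q (int i) * qpoch q b (2 * n - int i)) =
      t i + (w i - w (Suc i))" for i
  proof -
    have b1: "1 - b \<noteq> 0" using gen[of 0] by simp
    have bk: "1 - b * q powi k \<noteq> 0" for k using gen[of k] by simp
    \<comment> \<open>Both sides come from (b)_(k+1), split at its last and at its first
      factor.\<close>
    have bq: "qpoch q (b * q) k = qpoch q b k * (1 - b * q powi k) / (1 - b)" for k
      using qpoch_plus_1[OF gen] qpoch_plus_1'[of b k] b1
      by (simp add: nonzero_eq_divide_eq mult.commute)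
    have bq': "qpoch q (b * q) (2 * n - int (Suc i)) = qpoch q b (2 * n - int i) / (1 - b)"
      using qpoch_plus_1'[of b "2 * n - int (Suc i)"] b1 by (simp add: field_simps)
    have qS: "qpoch q q (int (Suc i)) = qpoch q q (int i) * (1 - q ^ Suc i)"
      using qpoch_q_rec[of "int (Suc i)"] by (simp only: power_int_of_nat) simp
    have qS_nz: "1 - q ^ Suc i \<noteq> 0"
      using q_power_int_neq_1[of "int (Suc i)"] by (simp only: power_int_of_nat) simp
    have e: "q powi (2 * n - int i) = q powi (2 * (n - int i)) * q ^ i"
      using q_nz power_int_add[of q "2 * (n - int i)" "int i"] by (simp add: power_int_of_nat)
    define X where "X = q powi (2 * (n - int i))"
    have X: "1 - b * X \<noteq> 0" "1 - b * (X * q ^ i) \<noteq> 0"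
      using bk[of "2 * (n - int i)"] bk[of "2 * n - int i"] by (simp_all only: e X_def) simp_all
    \<comment> \<open>The numerator 1 - b q^(2n-i) is the extra factor by which (bq)_(2n-i) differs
      from (b)_(2n-i)/(1-b), so it cancels next.\<close>
    have "t i + w i = t i * ((1 - b * (X * q ^ i)) / (1 - b * X))"
    proof -
      define Y where "Y = 1 - b * X"
      have r: "r i = (1 - Y) / Y" by (simp add: r_def X_def Y_def)
      have bX: "b * (X * q ^ i) = (1 - Y) * q ^ i" by (simp add: Y_def)
      have "Y \<noteq> 0" using X(1) by (simp add: Y_def)
      then show ?thesis unfolding w_def r bX Y_def[symmetric] by (simp add: field_simps)
    qed
    also have "\<dots> = (1 - b) * (\<alpha> (n - int i) / (1 - b * X)) /
        (qpoch q q (int i) * qpoch q b (2 * n - int i))"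
      unfolding t_def bq e X_def[symmetric] using X b1 by (simp add: mult_ac)
    finally have u: "t i + w i = (1 - b) * (\<alpha> (n - int i) / (1 - b * X)) /
        (qpoch q q (int i) * qpoch q b (2 * n - int i))" .
    have "w (Suc i) = (1 - b) * \<alpha> (n - int (Suc i)) * r (Suc i) /
        (qpoch q q (int i) * qpoch q b (2 * n - int i))"
      unfolding w_def t_def bq' qS using qS_nz b1 by (simp del: power_Suc of_nat_Suc)
    moreover have "n - int (Suc i) = n - int i - 1" by simp
    ultimately have v: "w (Suc i) = (1 - b) * (b * q powi (2 * (n - int i - 1)) * \<alpha> (n - int i - 1)
        / (1 - b * q powi (2 * (n - int i - 1)))) / (qpoch q q (int i) * qpoch q b (2 * n - int i))"
      by (simp add: r_def mult_ac del: of_nat_Suc)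
    have "t i + (w i - w (Suc i)) = (t i + w i) - w (Suc i)" by simp
    then show ?thesis
      unfolding u v by (simp only: bailey_step_def X_def right_diff_distrib diff_divide_distrib)
  qed
  have arg: "n - (n - int i) = int i" "n + (n - int i) = 2 * n - int i" "b / q * q = b" for i
    using q_nz by simp_all
  show "(\<lambda>i. bailey_step b \<alpha> (n - int i) /
      (qpoch q q (n - (n - int i)) * qpoch q (b / q * q) (n + (n - int i)))) sums \<beta> n"
    unfolding arg step by (rule sums)
qed

section \<open>The transformation as an iterated step\<close>

lemma bailey_alpha_finite_sum:
  assumes "finite J" "{0..int N} \<subseteq> J"
  shows "bailey_alpha q a \<alpha> N n =
    (1 - a * q powi (2 * n - int N)) * qpoch q (a * q powi (1 - int N)) (int N) *
    (\<Sum>j\<in>J. (-1) powi j *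
        (a powi j * q powi ((2 * n - int N) * j - j * (j + 1) div 2)
          / qpoch q (a * q powi (2 * n - int N - j)) (int N + 1)) *
        qbinom q N j * \<alpha> (n - j))"
  unfolding bailey_alpha_def infsum_finite[OF assms(1), symmetric]
  by (intro arg_cong2[where f = "(*)"] refl infsum_cong_neutral) (use assms in \<open>force simp: qbinom_def subset_iff\<close>)+

lemma bailey_alpha_0:
  assumes gen: "\<And>k::int. a * q powi k \<noteq> 1"
  shows "bailey_alpha q a \<alpha> 0 = \<alpha>"
proof
  fix n :: int
  have gen': "a * q powi m * q powi k \<noteq> 1" for m k
    using gen[of "m + k"] q_nz by (simp add: power_int_add mult.assoc)
  have "qpoch q (a * q powi (2 * n)) 1 = 1 - a * q powi (2 * n)"
    using qpoch_plus_1[of "a * q powi (2 * n)" 0] gen qpoch_0[OF gen'] by simp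
  moreover have "qpoch q (a * q) 0 = 1"
    using qpoch_0[OF gen'[of 1]] by simp
  ultimately show "bailey_alpha q a \<alpha> 0 n = \<alpha> n"
    using gen[of "2 * n"]
    by (subst bailey_alpha_finite_sum[of "{0}"]) (auto simp: qbinom_def qpoch_q_0)
qed

text \<open>Compare coefficients of \<alpha> at n - j. It occurs at index j of the sum for n and at
  index j - 1 of the sum for n - 1, so the claim reduces to \<open>coeff\<close>.\<close>

lemma bailey_alpha_Suc:
  assumes gen: "\<And>k::int. a * q powi k \<noteq> 1"
  shows "bailey_alpha q a \<alpha> (Suc N) = bailey_step (a * q powi (- int N)) (bailey_alpha q a \<alpha> N)"
proof
  fix n :: int
  define c where "c N n j = (-1) powi j *
        (a powi j * q powi ((2 * n - int N) * j - j * (j + 1) div 2)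
          / qpoch q (a * q powi (2 * n - int N - j)) (int N + 1)) * qbinom q N j" for N n j
  have gen': "a * q powi m * q powi k \<noteq> 1" for m k
    using gen[of "m + k"] q_nz by (simp add: power_int_add mult.assoc)
  have nz: "1 - a * q powi k \<noteq> 0" for k using gen[of k] by simp
  define P where "P = qpoch q (a * q powi (1 - int N)) (int N)"
  define b where "b = a * q powi (- int N)"
  have b: "b * q powi k = a * q powi (k - int N)" for k
    using q_nz by (simp add: b_def power_int_diff power_int_minus field_simps)
  have P: "qpoch q (a * q powi (1 - int (Suc N))) (int (Suc N)) = (1 - b) * P"
  proof -
    have "b * q = a * q powi (1 - int N)" using b[of 1] by simp
    moreover have "a * q powi (1 - int (Suc N)) = b" by (simp add: b_def)
    ultimately show ?thesis
      using qpoch_plus_1'[of b "int N"] by (simp only: P_def of_nat_Suc add.commute)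
  qed
  \<comment> \<open>The denominator in \<open>bailey_step\<close> equals the prefactor 1 - a
    q^(2n-N), so only P and the plain sum remain.\<close>
  have div: "bailey_alpha q a \<alpha> N n / (1 - b * q powi (2 * n)) = P * (\<Sum>j\<in>J. c N n j * \<alpha> (n - j))"
    if "finite J" "{0..int N} \<subseteq> J" for J n
    using nz[of "2 * n - int N"] unfolding bailey_alpha_finite_sum[OF that] b c_def P_def by simp
  have coeff: "(1 - a * q powi (2 * n - int (Suc N))) * c (Suc N) n j =
      c N n j - b * q powi (2 * (n - 1)) * c N (n - 1) (j - 1)" for j
  proof -
    \<comment> \<open>With this x the three denominators are (xq)_(N+1), (x)_(N+2) and (x)_(N+1).
      They share D = (xq)_N and differ only in the end factors 1 - x and 1 - xZ.\<close>
    define x where "x = a * q powi (2 * n - int N - 1 - j)"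
    define E where "E = q powi ((2 * n - int N - 1) * j - j * (j + 1) div 2)"
    define X where "X = q powi j"
    define Z where "Z = q powi (int N + 1)"
    define D where "D = qpoch q (x * q) (int N)"
    define Q where "Q = qbinom q N j"
    define R where "R = qbinom q N (j - 1)"
    define s where "s = (-1 :: complex) powi j * a powi j"
    have x_nz: "1 - x \<noteq> 0" using nz by (simp add: x_def)
    have xZ: "x * Z = x * q * q powi int N"
      using q_nz by (simp add: Z_def power_int_add mult_ac)
    have xZ': "x * Z = a * q powi (2 * n - j)"
      using q_nz by (simp add: x_def Z_def mult.assoc flip: power_int_add)
    have xZ_nz: "1 - x * Z \<noteq> 0" unfolding xZ' by (rule nz)
    have xX: "a * q powi (2 * n - int (Suc N)) = x * X"
      using q_nz by (simp add: x_def X_def mult.assoc algebra_simps flip: power_int_add)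
    have xq: "a * q powi (2 * n - int N - j) = x * q"
    proof -
      have "2 * n - int N - j = (2 * n - int N - 1 - j) + 1" by simp
      then show ?thesis by (simp only: x_def power_int_add_1[OF disjI1[OF q_nz]] mult.assoc)
    qed
    have D_nz: "D \<noteq> 0" unfolding D_def xq[symmetric] using gen' by (rule qpoch_nonzero)
    have poch1: "qpoch q x (int N + 1) = (1 - x) * D"
      unfolding D_def by (rule qpoch_plus_1')
    have poch2: "qpoch q (x * q) (int N + 1) = D * (1 - x * Z)"
      using qpoch_plus_1[of "x * q" "int N"] xZ_nz by (simp add: D_def xZ)
    have poch3: "qpoch q x (int (Suc N) + 1) = (1 - x) * D * (1 - x * Z)"
      using qpoch_plus_1'[of x "int N + 1"] poch2 by (simp add: add.commute)
    have pascal1: "qbinom q (Suc N) j = X * Q + R"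
      unfolding X_def Q_def R_def by (rule qbinom_Suc_left)
    have "X * q powi (int N + 1 - j) = Z"
      using q_nz by (simp add: X_def Z_def flip: power_int_add)
    then have pascal2: "X * qbinom q (Suc N) j = X * Q + Z * R"
      unfolding qbinom_Suc_right[of N j] Q_def R_def by (simp add: algebra_simps)
    have "q powi ((2 * n - int N) * j - j * (j + 1) div 2) = E * X"
      using q_nz by (simp add: E_def X_def algebra_simps flip: power_int_add)
    then have c1: "c N n j = s * E * X / (D * (1 - x * Z)) * Q"
      unfolding c_def s_def xq poch2 Q_def by simp
    have c2: "c (Suc N) n j = s * E / ((1 - x) * D * (1 - x * Z)) * qbinom q (Suc N) j"
    proof -
      have e: "2 * n - int (Suc N) = 2 * n - int N - 1" by simp
      show ?thesis
        unfolding c_def e x_def[symmetric] E_def[symmetric] poch3 s_def by simp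
    qed
    have c3: "b * q powi (2 * (n - 1)) * c N (n - 1) (j - 1) = - (s * E / ((1 - x) * D) * R)"
    \<comment> \<open>The value a = 0 is allowed, and then a * a^(j-1) = a^j fails at j = 0. For j <
      1 both sides vanish with the binomial at j - 1.\<close>
    proof (cases "j \<ge> 1")
      case True
      \<comment> \<open>Adding the even number 2j keeps the integer division under control:
        consecutive triangular numbers differ by j.\<close>
      have "j * (j + 1) = (j - 1) * (j - 1 + 1) + j * 2" by (simp add: algebra_simps)
      then have "j * (j + 1) div 2 = (j - 1) * (j - 1 + 1) div 2 + j" by simp
      then have E: "q powi (2 * (n - 1) - int N) *
          q powi ((2 * (n - 1) - int N) * (j - 1) - (j - 1) * (j - 1 + 1) div 2) = E"
        using q_nz unfolding E_def power_int_add[OF disjI1[OF q_nz], symmetric]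
        by (intro arg_cong[where f = "(powi) q"]) (simp add: algebra_simps)
      have s: "(-1 :: complex) powi (j - 1) * (a * a powi (j - 1)) = - s"
        using True power_int_add_1'[of a "j - 1"] by (simp add: s_def power_int_diff)
      have e: "2 * (n - 1) - int N - (j - 1) = 2 * n - int N - 1 - j" by simp
      have "b * q powi (2 * (n - 1)) * c N (n - 1) (j - 1) =
          ((-1) powi (j - 1) * (a * a powi (j - 1))) * (q powi (2 * (n - 1) - int N) *
          q powi ((2 * (n - 1) - int N) * (j - 1) - (j - 1) * (j - 1 + 1) div 2)) /
          ((1 - x) * D) * R"
        unfolding b c_def e x_def[symmetric] poch1 R_def by (simp only: times_divide_eq_right times_divide_eq_left mult_ac)
      then show ?thesis unfolding s E by simp
    next
      case False
      then show ?thesis by (simp add: c_def R_def qbinom_def)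
    qed
    \<comment> \<open>This is the first Pascal rule minus x q^j times the second; the factors 1 - x
      and 1 - xZ then cancel against the end factors.\<close>
    have "(1 - x * X) * qbinom q (Suc N) j = X * Q * (1 - x) + R * (1 - x * Z)"
    proof -
      have "(1 - x * X) * qbinom q (Suc N) j = qbinom q (Suc N) j - x * (X * qbinom q (Suc N) j)"
        by (simp add: algebra_simps)
      also have "\<dots> = X * Q + R - x * (X * Q + Z * R)"
        unfolding pascal2 unfolding pascal1 ..
      finally show ?thesis by (simp add: algebra_simps)
    qed
    then have "(1 - x * X) * c (Suc N) n j =
        s * E / ((1 - x) * D * (1 - x * Z)) * (X * Q * (1 - x) + R * (1 - x * Z))"
      unfolding c2 by (metis mult.left_commute)
    also have "\<dots> = s * E * X / (D * (1 - x * Z)) * Q + s * E / ((1 - x) * D) * R"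
      using x_nz xZ_nz D_nz by (simp add: distrib_left mult.assoc)
    finally show ?thesis unfolding xX c1 c3 by simp
  qed
  have "bailey_alpha q a \<alpha> (Suc N) n =
      (1 - b) * P * (\<Sum>j\<in>{0..int (Suc N)}.
        (1 - a * q powi (2 * n - int (Suc N))) * c (Suc N) n j * \<alpha> (n - j))"
    by (subst bailey_alpha_finite_sum[of "{0..int (Suc N)}"])
       (simp_all only: P c_def finite_atLeastAtMost_int subset_refl sum_distrib_left mult_ac)
  also have "\<dots> = (1 - b) * (P * (\<Sum>j\<in>{0..int (Suc N)}. c N n j * \<alpha> (n - j))
      - b * q powi (2 * (n - 1)) *
        (P * (\<Sum>j\<in>{0..int (Suc N)}. c N (n - 1) (j - 1) * \<alpha> (n - j))))"
    unfolding coeff by (simp add: sum_subtractf sum_distrib_left algebra_simps)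
  \<comment> \<open>The shift produces an extra index -1, where the coefficient is zero.\<close>
  also have "(\<Sum>j\<in>{0..int (Suc N)}. c N (n - 1) (j - 1) * \<alpha> (n - j)) =
      (\<Sum>j\<in>{-1..int N}. c N (n - 1) j * \<alpha> (n - 1 - j))"
    by (rule sum.reindex_bij_witness[of _ "\<lambda>j. j + 1" "\<lambda>j. j - 1"]) auto
  also have "P * (\<Sum>j\<in>{0..int (Suc N)}. c N n j * \<alpha> (n - j)) =
      bailey_alpha q a \<alpha> N n / (1 - b * q powi (2 * n))"
    by (rule div[symmetric]) auto
  also have "P * (\<Sum>j\<in>{-1..int N}. c N (n - 1) j * \<alpha> (n - 1 - j)) =
      bailey_alpha q a \<alpha> N (n - 1) / (1 - b * q powi (2 * (n - 1)))"
    by (rule div[symmetric]) auto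
  finally show "bailey_alpha q a \<alpha> (Suc N) n =
      bailey_step (a * q powi (- int N)) (bailey_alpha q a \<alpha> N) n"
    by (simp add: bailey_step_def b_def)
qed

end

section \<open>Induction on N\<close>

theorem theorem3p1:
  fixes a q :: complex and \<alpha> \<beta> :: "int \<Rightarrow> complex"
  assumes "q \<noteq> 0" and "norm q < 1"
    and generic: "\<And>k::int. a \<noteq> q powi k"
    and "bilateral_bailey_pair q a \<alpha> \<beta>"
  shows "\<forall>N::nat. bilateral_bailey_pair q (a * q powi (- int N))
           (bailey_alpha q a \<alpha> N) (bailey_beta \<beta> N)"
proof
  fix N :: nat
  note q = \<open>q \<noteq> 0\<close> \<open>norm q < 1\<close>
  have gen: "a * q powi k \<noteq> 1" for k
    using generic[of "- k"] q by (auto simp: power_int_minus field_simps)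
  show "bilateral_bailey_pair q (a * q powi (- int N)) (bailey_alpha q a \<alpha> N) (bailey_beta \<beta> N)"
  proof (induction N)
    case 0
    then show ?case
      using assms(4) by (simp add: bailey_alpha_0[OF q gen] bailey_beta_def[abs_def])
  next
    case (Suc N)
    \<comment> \<open>Genericity over all integer exponents survives the shift to b = a q^(-N), so
      the step applies to b at every stage.\<close>
    have "a * q powi (- int N) * q powi k \<noteq> 1" for k
      using gen[of "k - int N"] q by (simp add: power_int_diff power_int_minus field_simps)
    from bilateral_bailey_pair_step[OF q this Suc.IH]
    have "bilateral_bailey_pair q (a * q powi (- int N) / q) (bailey_alpha q a \<alpha> (Suc N)) (bailey_beta \<beta> N)"
      by (simp add: bailey_alpha_Suc[OF q gen])
    moreover have "a * q powi (- int N) / q = a * q powi (- int (Suc N))"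
    proof -
      have "- int N = - int (Suc N) + 1" by simp
      then have "q powi (- int N) = q powi (- int (Suc N)) * q"
        by (simp only: power_int_add_1[OF disjI1[OF q(1)]])
      then show ?thesis using q by (simp del: of_nat_Suc)
    qed
    moreover have "bailey_beta \<beta> (Suc N) = bailey_beta \<beta> N"
      by (simp add: bailey_beta_def[abs_def])
    ultimately show ?case by simp
  qed
qed

end
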